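(* Let $q$ be an odd prime power with $q\equiv 1\pmod 4$, and let $r$ be an odd positive divisor of $\frac{q-1}{2}$. Then $\rho(\mathrm{PSL}(2,q),\mathbb M_r)=1$.
   Context: For a finite group $G$ and a subgroup $H\le G$, a subset $\mathcal F\subseteq G$ is called $H$-intersecting if for all $g,g'\in\mathcal F$ there is $x\in G$ with $gxH=g'xH$. The intersection density is $\rho(G,H)=\max\{|\mathcal F|/|H| : \mathcal F\subseteq G \text{ is } H\text{-intersecting}\}$. Elements of $\mathrm{PSL}(2,q)=\mathrm{SL}(2,q)/\{\pm I\}$ are written $\overline{M}$ for $M\in\mathrm{SL}(2,q)$. Let $\omega$ be a generator of $\mathbb F_q^*$. Let $H_0=\{\overline{\begin{bmatrix}1&x\\0&1\end{bmatrix}}: x\in\mathbb F_q\}$ and $A=\overline{\begin{bmatrix}\omega&0\\0&\omega^{-1}\end{bmatrix}}$ (of order $\frac{q-1}{2}$). Define $\mathbb M_r=\langle H_0,A^r\rangle=H_0\rtimes\langle A^r\rangle\cong\mathbb F_q\rtimes\mathbb Z_{\frac{q-1}{2r}}$; it has index $r$ in the Borel subgroup $\mathbb B_q=H_0\rtimes\langle A\rangle$ of upper triangular elements. *)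

theory Defs
  imports Complex_Main "HOL-Algebra.Coset" "HOL-Algebra.Generated_Groups"
begin

text \<open>2x2 matrices over a field, written (a,b,c,d) for [[a,b],[c,d]].\<close>
type_synonym 'a mat22 = "'a \<times> 'a \<times> 'a \<times> 'a"

fun mat22_mult :: "'a::field mat22 \<Rightarrow> 'a mat22 \<Rightarrow> 'a mat22" where
  "mat22_mult (a, b, c, d) (e, f, g, h) =
     (a * e + b * g, a * f + b * h, c * e + d * g, c * f + d * h)"

definition SL2 :: "('a::field mat22) monoid" where
  "SL2 = \<lparr> carrier = {(a, b, c, d). a * d - b * c = 1},
           mult = mat22_mult,
           one = (1, 0, 0, 1) \<rparr>"

definition SL2_center :: "('a::field mat22) set" where
  "SL2_center = {(1, 0, 0, 1), (-1, 0, 0, -1)}"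

definition PSL2 :: "('a::field mat22 set) monoid" where
  "PSL2 = SL2 Mod SL2_center"

definition psl_class :: "'a::field mat22 \<Rightarrow> 'a mat22 set" where
  "psl_class M = SL2_center #>\<^bsub>SL2\<^esub> M"

definition H0 :: "('a::field mat22 set) set" where
  "H0 = {psl_class (1, x, 0, 1) | x. True}"

definition diagA :: "'a::field \<Rightarrow> 'a mat22 set" where
  "diagA \<omega> = psl_class (\<omega>, 0, 0, inverse \<omega>)"

definition M_r :: "'a::field \<Rightarrow> nat \<Rightarrow> ('a mat22 set) set" where
  "M_r \<omega> r = generate PSL2 (H0 \<union> {diagA \<omega> [^]\<^bsub>PSL2\<^esub> r})"

definition H_intersecting :: "('g, 'b) monoid_scheme \<Rightarrow> 'g set \<Rightarrow> 'g set \<Rightarrow> bool" where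
  "H_intersecting G H F \<longleftrightarrow> F \<subseteq> carrier G \<and>
     (\<forall>g\<in>F. \<forall>g'\<in>F. \<exists>x\<in>carrier G. (g \<otimes>\<^bsub>G\<^esub> x) <#\<^bsub>G\<^esub> H = (g' \<otimes>\<^bsub>G\<^esub> x) <#\<^bsub>G\<^esub> H)"

definition intersection_density :: "('g, 'b) monoid_scheme \<Rightarrow> 'g set \<Rightarrow> real" where
  "intersection_density G H =
     Max ((\<lambda>F. real (card F) / real (card H)) ` {F. H_intersecting G H F})"

end

theory Submission
  imports Defs "HOL-Library.Product_Plus" "HOL-Library.Cardinality"
begin

text \<open>
  Everything is lifted to \<open>SL(2,q)\<close>. A family \<open>F\<close> of classes becomes a family of matrices closed
  under negation in which every quotient has trace \<open>a + 1/a\<close> with \<open>a\<close> in \<open>R\<close>, the set of nonzero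
  \<open>r\<close>-th powers; it has to be shown that such a family has size \<open>n \<le> q |R|\<close>.

  First, the sum of the cuspidal characters is positive semidefinite. Up to a factor it is the kernel
  whose value is \<open>4\<close> on elliptic quotients, \<open>0\<close> on split ones, \<open>1 - q\<close> on nontrivial elements
  of trace \<open>2\<close> or \<open>-2\<close>, and \<open>(q - 1)\<^sup>2\<close> on \<open>I\<close> and \<open>-I\<close>. It sums to zero over each
  set \<open>{g. g v = w}\<close>, and it differs from a positive multiple of the identity kernel by a combination
  of indicator functions of such sets, namely counts of solutions \<open>v\<close> of \<open>x v = l (y v)\<close>. Since \<open>F\<close> has no
  elliptic quotients, the number \<open>P\<close> of pairs in \<open>F\<close> with quotient of trace \<open>2\<close> or \<open>-2\<close> is at
  most \<open>2 q n\<close>.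

  Second, let \<open>\<nu> l\<close> count the triples of \<open>x\<close>, \<open>y\<close> in \<open>F\<close> and a nonzero vector \<open>v\<close> with
  \<open>x v = l (y v)\<close>. By Cauchy-Schwarz \<open>\<nu> l \<le> \<nu> 1\<close>. Summing over \<open>l\<close> in \<open>R\<close> gives
  \<open>(q - 1) (2 n\<^sup>2 - P + 2 q n) \<le> |R| (q - 1) (P + 2 q n) / 2\<close>, and the bound on \<open>P\<close> turns this
  into \<open>n \<le> q |R|\<close>.
\<close>

text \<open>The polar form of the determinant; on \<open>SL(2,q)\<close> it is the trace of \<open>x\<inverse> y\<close>.\<close>

fun polar :: "'a::field mat22 \<Rightarrow> 'a mat22 \<Rightarrow> 'a" where
  "polar (a, b, c, d) (e, f, g, h) = a * h + d * e - b * g - c * f"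

fun adjugate :: "'a::field mat22 \<Rightarrow> 'a mat22" where
  "adjugate (a, b, c, d) = (d, -b, -c, a)"

fun act :: "'a::field mat22 \<Rightarrow> 'a \<times> 'a \<Rightarrow> 'a \<times> 'a" where
  "act (a, b, c, d) (v, w) = (a * v + b * w, c * v + d * w)"

fun scale :: "'a::field \<Rightarrow> 'a \<times> 'a \<Rightarrow> 'a \<times> 'a" where
  "scale l (v, w) = (l * v, l * w)"

section \<open>Matrix arithmetic in SL(2,q) and its action on the plane\<close>

lemma mem_SL2: "(a, b, c, d) \<in> carrier SL2 \<longleftrightarrow> a * d - b * c = 1"
  by (simp add: SL2_def)

lemma mat22_assoc: "mat22_mult (mat22_mult x y) z = mat22_mult x (mat22_mult y z)"
  by (cases x; cases y; cases z) (simp add: algebra_simps)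

lemma act_mult: "act (mat22_mult x y) v = act x (act y v)"
  by (cases x; cases y; cases v) (simp add: algebra_simps)

lemma mult_closed: "x \<in> carrier SL2 \<Longrightarrow> y \<in> carrier SL2 \<Longrightarrow> mat22_mult x y \<in> carrier SL2"
proof (cases x; cases y)
  fix a b c d e f g h
  assume "x \<in> carrier SL2" "y \<in> carrier SL2" "x = (a, b, c, d)" "y = (e, f, g, h)"
  then have "a * d - b * c = 1" "e * h - f * g = 1" by (auto simp: mem_SL2)
  moreover have "(a * e + b * g) * (c * f + d * h) - (a * f + b * h) * (c * e + d * g)
      = (a * d - b * c) * (e * h - f * g)" by (simp add: algebra_simps)
  ultimately show ?thesis using \<open>x = _\<close> \<open>y = _\<close> by (simp add: mem_SL2)
qed

lemma one_closed: "(1, 0, 0, 1) \<in> carrier SL2"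
  by (simp add: mem_SL2)

lemma mult_one: "mat22_mult (1, 0, 0, 1) x = x" "mat22_mult x (1, 0, 0, 1) = x"
  by (cases x; simp)+

lemma act_one: "act (1, 0, 0, 1) v = v"
  by (cases v) simp

lemma adjugate_closed: "x \<in> carrier SL2 \<Longrightarrow> adjugate x \<in> carrier SL2"
  by (cases x) (simp add: mem_SL2 algebra_simps)

lemma adjugate_inverse:
  assumes "x \<in> carrier SL2"
  shows "mat22_mult (adjugate x) x = (1, 0, 0, 1)" "mat22_mult x (adjugate x) = (1, 0, 0, 1)"
  using assms by (cases x; simp add: mem_SL2 algebra_simps)+

lemma mult_cancel:
  assumes "m \<in> carrier SL2"
  shows "mat22_mult m x = mat22_mult m y \<longleftrightarrow> x = y"
    and "mat22_mult x m = mat22_mult y m \<longleftrightarrow> x = y"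
  using adjugate_inverse[OF assms] by (metis mat22_assoc mult_one)+

lemma mult_minus: "mat22_mult (- x) y = - mat22_mult x y" "mat22_mult x (- y) = - mat22_mult x y"
  by (cases x; cases y; simp)+

lemma minus_closed: "x \<in> carrier SL2 \<Longrightarrow> - x \<in> carrier SL2"
  by (cases x) (simp add: mem_SL2)

lemma act_minus: "act (- x) v = - act x v"
  by (cases x; cases v) simp

lemma act_nonzero:
  assumes "x \<in> carrier SL2" "v \<noteq> 0"
  shows "act x v \<noteq> 0"
proof
  assume "act x v = 0"
  then have "act (adjugate x) (act x v) = 0" by (cases x) (simp add: zero_prod_def)
  then show False using assms adjugate_inverse[OF assms(1)]
    by (simp flip: act_mult add: act_one)
qed

text \<open>\<open>polar x y\<close> is det (x + y) - det x - det y, and multiplication by a matrix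
  of determinant 1 preserves every determinant.\<close>

lemma polar_mult_left: "m \<in> carrier SL2 \<Longrightarrow> polar (mat22_mult m x) (mat22_mult m y) = polar x y"
proof (cases m; cases x; cases y)
  fix a b c d a' b' c' d' e f g h
  assume "m \<in> carrier SL2" and eq: "m = (a, b, c, d)" "x = (a', b', c', d')" "y = (e, f, g, h)"
  then have "a * d - b * c = 1" by (simp add: mem_SL2)
  moreover have "polar (mat22_mult m x) (mat22_mult m y) = (a * d - b * c) * polar x y"
    by (simp add: eq algebra_simps)
  ultimately show ?thesis by simp
qed

lemma polar_mult_right: "m \<in> carrier SL2 \<Longrightarrow> polar (mat22_mult x m) (mat22_mult y m) = polar x y"
proof (cases m; cases x; cases y)
  fix a b c d a' b' c' d' e f g h
  assume "m \<in> carrier SL2" and eq: "m = (a, b, c, d)" "x = (a', b', c', d')" "y = (e, f, g, h)"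
  then have "a * d - b * c = 1" by (simp add: mem_SL2)
  moreover have "polar (mat22_mult x m) (mat22_mult y m) = (a * d - b * c) * polar x y"
    by (simp add: eq algebra_simps)
  ultimately show ?thesis by simp
qed

text \<open>Any nonzero vector can be completed to a basis of determinant 1, so SL(2,q) is
  transitive on nonzero vectors.\<close>

lemma obtain_first_column:
  fixes v :: "'a::field \<times> 'a"
  assumes "v \<noteq> 0"
  obtains m where "m \<in> carrier SL2" "act m (1, 0) = v"
proof (cases v)
  case (Pair p s)
  show ?thesis
  proof (cases "p = 0")
    case True
    then show ?thesis using assms Pair that[of "(p, - inverse s, s, 0)"]
      by (auto simp: mem_SL2 zero_prod_def)
  next
    case False
    then show ?thesis using assms Pair that[of "(p, 0, s, inverse p)"]
      by (auto simp: mem_SL2 zero_prod_def)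
  qed
qed

section \<open>The cuspidal kernel and its sums over fibers\<close>

definition delta :: "'a::field mat22 \<Rightarrow> 'a mat22 \<Rightarrow> real" where
  "delta x y = of_bool (x = y) + of_bool (x = - y)"

definition parabolic :: "'a::field \<Rightarrow> real" where
  "parabolic t = of_bool (t = 2) + of_bool (t = -2)"

text \<open>The eigenvalues in the base field of a matrix in \<open>SL(2,q)\<close> of trace \<open>t\<close>.\<close>

definition eigenvalues :: "'a::field \<Rightarrow> 'a set" where
  "eigenvalues t = {l. l\<^sup>2 - t * l + 1 = 0}"

text \<open>In odd characteristic this is 4, 0 or 1 - q for elliptic, split and parabolic traces. It
  is written through \<open>parabolic\<close> and \<open>eigenvalues\<close> because these are the
  quantities that the counts \<open>fixcount\<close> produce.\<close>

definition trace_weight :: "'a::field \<Rightarrow> real" where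
  "trace_weight t = 4 - (real CARD('a) + 1) * parabolic t - 2 * real (card (eigenvalues t))"

definition cusp_kernel :: "'a::field mat22 \<Rightarrow> 'a mat22 \<Rightarrow> real" where
  "cusp_kernel x y = real CARD('a) * (real CARD('a) - 1) * delta x y + trace_weight (polar x y)"

lemma eigenvalues_eq:
  fixes a :: "'a::field"
  assumes "a \<noteq> 0"
  shows "eigenvalues (a + inverse a) = {a, inverse a}"
proof -
  have "l\<^sup>2 - (a + inverse a) * l + 1 = (l - a) * (l - inverse a)" for l
    using assms by (simp add: algebra_simps power2_eq_square)
  then show ?thesis by (auto simp: eigenvalues_def)
qed

lemma zero_notin_eigenvalues: "0 \<notin> eigenvalues t"
  by (simp add: eigenvalues_def)

lemma mem_eigenvalues:
  "l \<in> eigenvalues t \<longleftrightarrow> l \<noteq> 0 \<and> t = l + inverse (l :: 'a::field)"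
proof (cases "l = 0")
  case False
  then have "l\<^sup>2 - t * l + 1 = l * (l + inverse l - t)"
    by (simp add: algebra_simps power2_eq_square)
  then show ?thesis using False by (auto simp: eigenvalues_def)
qed (simp add: eigenvalues_def)

lemma minus_one_neq_one: "(2::'a::field) \<noteq> 0 \<Longrightarrow> (-1::'a) \<noteq> 1"
  by (metis add.right_inverse one_add_one)

lemma trace_eq_two_iff:
  fixes a :: "'a::field"
  assumes "a \<noteq> 0"
  shows "a + inverse a = 2 \<longleftrightarrow> a = 1" "a + inverse a = -2 \<longleftrightarrow> a = -1"
proof -
  have "a * (a + inverse a - 2) = (a - 1)\<^sup>2" "a * (a + inverse a + 2) = (a + 1)\<^sup>2"
    using assms by (simp_all add: algebra_simps power2_eq_square)
  then show "a + inverse a = 2 \<longleftrightarrow> a = 1" "a + inverse a = -2 \<longleftrightarrow> a = -1"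
    using assms by (metis eq_iff_diff_eq_0 mult_eq_0_iff power2_eq_square,
      metis add_eq_0_iff2 add.inverse_inverse add.commute mult_eq_0_iff power2_eq_square)
qed

text \<open>The two roots \<open>a\<close> and \<open>inverse a\<close> coincide exactly for a = 1
  and a = -1, that is, for trace 2 and -2.\<close>

lemma card_eigenvalues:
  fixes a :: "'a::field"
  assumes "(2::'a) \<noteq> 0" "a \<noteq> 0"
  shows "real (card (eigenvalues (a + inverse a))) = 2 - parabolic (a + inverse a)"
proof -
  have "a = inverse a \<longleftrightarrow> a = 1 \<or> a = -1"
    using assms(2) by (metis divide_self_if inverse_eq_divide  nonzero_divide_eq_eq square_eq_1_iff)
  then show ?thesis
    using assms minus_one_neq_one[OF assms(1)]
    by (auto simp: eigenvalues_eq parabolic_def trace_eq_two_iff card_insert_if)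
qed

text \<open>Each nonzero l is an eigenvalue for exactly one trace, namely l + 1/l.\<close>

lemma sum_card_eigenvalues:
  "(\<Sum>t\<in>(UNIV::'a::{field,finite} set). card (eigenvalues t)) = CARD('a) - 1"
proof -
  have "(\<Sum>t\<in>(UNIV::'a set). card (eigenvalues t)) = card (\<Union>t\<in>UNIV. eigenvalues (t::'a))"
    by (subst card_UN_disjoint) (auto simp: mem_eigenvalues)
  also have "(\<Union>t\<in>UNIV. eigenvalues (t::'a)) = UNIV - {0}"
    by (auto simp: mem_eigenvalues)
  finally show ?thesis by (simp add: card_Diff_singleton)
qed

text \<open>The total is 4 q - 2 (q + 1) - 2 (q - 1).\<close>

lemma sum_trace_weight: "(\<Sum>t\<in>(UNIV::'a::{field,finite} set). trace_weight t) = 0"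
proof -
  have "(\<Sum>t\<in>(UNIV::'a set). real (card (eigenvalues t))) = real CARD('a) - 1"
    unfolding of_nat_sum[symmetric] sum_card_eigenvalues
    by (simp add: of_nat_diff Suc_leI)
  moreover have "(\<Sum>t\<in>(UNIV::'a set). parabolic t) = 2"
    by (simp add: parabolic_def sum.distrib of_bool_def)
  ultimately show ?thesis
    by (simp add: trace_weight_def sum_subtractf flip: sum_distrib_left)
qed

text \<open>Let c be the lower left entry of \<open>y\<close>. For c nonzero the trace a + d - x c
  runs through the field once, so the weights cancel. For c = 0 the trace is constant with weight (1
  - q) \<open>parabolic\<close>; q copies of it cancel against q (q - 1) times the sum of
  \<open>delta\<close>, which is \<open>parabolic\<close> again.\<close>

lemma sum_cusp_kernel_unipotent:
  fixes y :: "'a::{field,finite} mat22"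
  assumes two: "(2::'a) \<noteq> 0" and y: "y \<in> carrier SL2"
  shows "(\<Sum>x\<in>UNIV. cusp_kernel (1, x, 0, 1) y) = 0"
proof (cases y)
  case (fields a b c d)
  let ?q = "real CARD('a)"
  have pol: "polar (1, x, 0, 1) y = a + d - x * c" for x
    by (simp add: fields algebra_simps)
  show ?thesis
  proof (cases "c = 0")
    case False
    then have "delta (1, x, 0, 1) y = 0" for x by (simp add: delta_def fields)
    then have "(\<Sum>x\<in>UNIV. cusp_kernel (1, x, 0, 1) y) = (\<Sum>x\<in>UNIV. trace_weight (a + d - x * c))"
      by (simp add: cusp_kernel_def pol)
    also have "\<dots> = (\<Sum>t\<in>(UNIV::'a set). trace_weight t)"
      by (rule sum.reindex_bij_witness[where j = "\<lambda>x. a + d - x * c" and i = "\<lambda>t. (a + d - t) / c"])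
        (use False in \<open>auto simp: field_simps\<close>)
    finally show ?thesis by (simp add: sum_trace_weight)
  next
    case True
    then have a: "a \<noteq> 0" and d: "d = inverse a"
      using y by (auto simp: fields mem_SL2 inverse_unique)
    have ne: "(-1::'a) \<noteq> 1" using minus_one_neq_one[OF two] .
    have "(\<Sum>x\<in>UNIV. delta (1, x, 0, 1) y) = parabolic (a + d)"
    proof -
      have "(1, x, 0, 1) = y \<longleftrightarrow> a = 1 \<and> x = b" "(1, x, 0, 1) = - y \<longleftrightarrow> a = -1 \<and> x = - b" for x
        using ne by (auto simp: fields True d) (metis minus_minus)
      then show ?thesis
        using trace_eq_two_iff[OF a] by (simp add: delta_def parabolic_def d sum.distrib of_bool_def)
    qed
    then show ?thesis
      using card_eigenvalues[OF two a]
      by (simp add: cusp_kernel_def pol True sum.distrib trace_weight_def d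
          flip: sum_distrib_left) (simp add: algebra_simps)
  qed
qed

lemma cusp_kernel_mult:
  assumes "m \<in> carrier SL2" "k \<in> carrier SL2"
  shows "cusp_kernel (mat22_mult (mat22_mult m x) k) (mat22_mult (mat22_mult m y) k) = cusp_kernel x y"
proof -
  have "mat22_mult (mat22_mult m x) k = - mat22_mult (mat22_mult m y) k \<longleftrightarrow> x = - y"
    by (metis assms mult_cancel mult_minus)
  then show ?thesis
    using assms by (simp add: cusp_kernel_def delta_def polar_mult_left polar_mult_right mult_cancel)
qed

text \<open>The kernel is invariant under left and right translation, so both \<open>v\<close> and
  \<open>w\<close> may be moved to (1, 0), whose stabilizer is the unipotent group just
  treated.\<close>

lemma sum_cusp_kernel_fiber:
  fixes y :: "'a::{field,finite} mat22"
  assumes two: "(2::'a) \<noteq> 0" and y: "y \<in> carrier SL2" and "v \<noteq> 0" "w \<noteq> 0"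
  shows "(\<Sum>g | g \<in> carrier SL2 \<and> act g v = w. cusp_kernel g y) = 0"
proof -
  obtain k where k: "k \<in> carrier SL2" "act k (1, 0) = v" using obtain_first_column \<open>v \<noteq> 0\<close> by blast
  obtain m where m: "m \<in> carrier SL2" "act m (1, 0) = w" using obtain_first_column \<open>w \<noteq> 0\<close> by blast
  define k' m' where "k' = adjugate k" and "m' = adjugate m"
  have first: "act (adjugate x) (act x (1, 0)) = (1, 0)" if "x \<in> carrier SL2" for x :: "'a mat22"
    using adjugate_inverse(1)[OF that] by (metis act_mult act_one)
  have k': "k' \<in> carrier SL2" "mat22_mult k k' = (1, 0, 0, 1)" "mat22_mult k' k = (1, 0, 0, 1)"
    "act k' v = (1, 0)"
    using k adjugate_closed adjugate_inverse first k'_def by blast+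
  have m': "m' \<in> carrier SL2" "mat22_mult m m' = (1, 0, 0, 1)" "mat22_mult m' m = (1, 0, 0, 1)"
    "act m' w = (1, 0)"
    using m adjugate_closed adjugate_inverse first m'_def by blast+
  have cancel: "mat22_mult m (mat22_mult m' x) = x" "mat22_mult m' (mat22_mult m x) = x"
    "mat22_mult k (mat22_mult k' x) = x" "mat22_mult k' (mat22_mult k x) = x" for x
    using k' m' by (metis mat22_assoc mult_one(1))+
  \<comment> \<open>The fiber is the set of all \<open>m u k\<inverse>\<close> with \<open>u\<close> unipotent upper triangular.\<close>
  let ?u = "\<lambda>x::'a. (1, x, 0, 1)"
  let ?f = "\<lambda>x. mat22_mult (mat22_mult m (?u x)) k'"
  let ?h = "\<lambda>g. mat22_mult (mat22_mult m' g) k"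
  have u: "?u x \<in> carrier SL2" for x by (simp add: mem_SL2)
  \<comment> \<open>A matrix of determinant 1 fixing (1, 0) is unipotent upper triangular, hence
    determined by its upper right entry \<open>fst (snd _)\<close>.\<close>
  have recover: "?h g = ?u (fst (snd (?h g)))" if "g \<in> carrier SL2" "act g v = w" for g
  proof -
    have "?h g \<in> carrier SL2" using that k m' mult_closed by blast
    moreover have "act (?h g) (1, 0) = (1, 0)" by (simp add: act_mult k that m')
    ultimately show ?thesis by (cases "?h g") (simp add: mem_SL2)
  qed
  have "(\<Sum>g | g \<in> carrier SL2 \<and> act g v = w. cusp_kernel g y) = (\<Sum>x\<in>UNIV. cusp_kernel (?f x) y)"
  proof (rule sum.reindex_bij_witness[where j = "\<lambda>g. fst (snd (?h g))" and i = ?f])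
    fix g assume "g \<in> {g. g \<in> carrier SL2 \<and> act g v = w}"
    then have "?f (fst (snd (?h g))) = mat22_mult (mat22_mult m (?h g)) k'"
      using recover by auto
    also have "\<dots> = g" by (simp only: mat22_assoc cancel k' mult_one)
    finally show "?f (fst (snd (?h g))) = g" "cusp_kernel (?f (fst (snd (?h g)))) y = cusp_kernel g y"
      by simp_all
  next
    fix x
    show "fst (snd (?h (?f x))) = x" by (simp only: mat22_assoc cancel k' mult_one) simp
    show "?f x \<in> {g. g \<in> carrier SL2 \<and> act g v = w}"
      using mult_closed[OF mult_closed[OF m(1) u] k'(1)]
      by (simp add: act_mult k' del: mat22_mult.simps) (simp add: m)
  qed auto
  also have "\<dots> = (\<Sum>x\<in>UNIV. cusp_kernel (?u x) (mat22_mult (mat22_mult m' y) k))"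
  proof (rule sum.cong[OF refl])
    fix x
    have y': "mat22_mult (mat22_mult m (mat22_mult (mat22_mult m' y) k)) k' = y"
      by (simp only: mat22_assoc cancel k' mult_one)
    show "cusp_kernel (?f x) y = cusp_kernel (?u x) (mat22_mult (mat22_mult m' y) k)"
      using cusp_kernel_mult[OF m(1) k'(1), of "?u x" "mat22_mult (mat22_mult m' y) k"] by (simp only: y')
  qed
  also have "\<dots> = 0"
    using sum_cusp_kernel_unipotent[OF two] mult_closed y m'(1) k(1) by blast
  finally show ?thesis .
qed

section \<open>Counting solutions of x v = l (y v)\<close>

text \<open>For \<open>y\<close> in SL(2,q) these are the eigenvectors of the quotient of
  \<open>x\<close> by \<open>y\<close> for eigenvalue \<open>l\<close>. Without an inverse, the
  condition compares the images of \<open>v\<close> under \<open>x\<close> and \<open>y\<close>,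
  which suits double counting over \<open>v\<close>.\<close>

definition fixcount :: "'a::field \<Rightarrow> 'a mat22 \<Rightarrow> 'a mat22 \<Rightarrow> real" where
  "fixcount l x y = real (card {v. v \<noteq> 0 \<and> act x v = scale l (act y v)})"

lemma line_kernel:
  fixes a b :: "'a::field"
  assumes "a \<noteq> 0 \<or> b \<noteq> 0"
  shows "a * v + b * w = 0 \<longleftrightarrow> (\<exists>s. v = - b * s \<and> w = a * s)"
proof
  assume eq: "a * v + b * w = 0"
  show "\<exists>s. v = - b * s \<and> w = a * s"
  proof (cases "a = 0")
    case True
    then show ?thesis using eq assms by (intro exI[of _ "- v / b"]) auto
  next
    case False
    have "a * v = - b * w" using eq by (simp add: eq_neg_iff_add_eq_0)
    then show ?thesis using False by (intro exI[of _ "w / a"]) (simp add: field_simps)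
  qed
qed (auto simp: algebra_simps)

text \<open>A nonzero singular matrix has rank one, so its kernel is a line.\<close>

lemma card_kernel:
  fixes a b c d :: "'a::{field,finite}"
  assumes "a * d - b * c = 0" "(a, b, c, d) \<noteq> 0"
  shows "card {v. v \<noteq> 0 \<and> act (a, b, c, d) v = 0} = CARD('a) - 1"
proof -
  \<comment> \<open>It suffices that one nonzero row \<open>(e, f)\<close> cuts out the kernel,
    which is then spanned by \<open>(-f, e)\<close>.\<close>
  have key: "card {v. v \<noteq> 0 \<and> act (a, b, c, d) v = 0} = CARD('a) - 1"
    if "e \<noteq> 0 \<or> f \<noteq> 0" and "\<And>v w. act (a, b, c, d) (v, w) = 0 \<longleftrightarrow> e * v + f * w = 0" for e f
  proof -
    have "act (a, b, c, d) (v, w) = (0, 0) \<longleftrightarrow> (\<exists>s. v = - f * s \<and> w = e * s)" for v w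
      using that(2) line_kernel[OF that(1)] by (simp add: zero_prod_def del: act.simps)
    then have "{v. v \<noteq> 0 \<and> act (a, b, c, d) v = 0} = (\<lambda>s. (- f * s, e * s)) ` (UNIV - {0})"
      using that(1) by (auto simp: zero_prod_def image_iff simp del: act.simps) blast+
    moreover have "inj_on (\<lambda>s. (- f * s, e * s)) (UNIV - {0})"
      using that(1) by (auto simp: inj_on_def)
    ultimately show ?thesis by (simp add: card_image card_Diff_singleton)
  qed
  show ?thesis
  proof (cases "a \<noteq> 0 \<or> b \<noteq> 0")
    case True
    have "c * v + d * w = 0" if vw: "a * v + b * w = 0" for v w
    proof -
      obtain s where s: "v = - b * s" "w = a * s" using line_kernel[OF True] vw by blast
      have "c * v + d * w = (a * d - b * c) * s" unfolding s by (simp add: algebra_simps)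
      then show ?thesis by (simp only: assms(1) mult_zero_left)
    qed
    then show ?thesis using True by (intro key[of a b]) (auto simp: zero_prod_def)
  next
    case False
    then show ?thesis using assms(2) by (intro key[of c d]) (auto simp: zero_prod_def)
  qed
qed

text \<open>The solutions form the kernel of x - l y, whose determinant is the polynomial defining
  \<open>eigenvalues (polar x y)\<close> at \<open>l\<close>. The kernel is the plane, with (q - 1)
  (1 + q) nonzero vectors, if x = l y; otherwise it is a line or 0.\<close>

lemma fixcount_eq:
  fixes x y :: "'a::{field,finite} mat22"
  assumes "x \<in> carrier SL2" "y \<in> carrier SL2" "l \<noteq> 0"
  shows "fixcount l x y = (real CARD('a) - 1) * (of_bool (l \<in> eigenvalues (polar x y))
    + real CARD('a) * of_bool (l = 1 \<and> x = y \<or> l = -1 \<and> x = - y))"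
proof (cases x; cases y)
  fix a b c d e f g h
  assume eq: "x = (a, b, c, d)" "y = (e, f, g, h)"
  let ?Z = "(a - l * e, b - l * f, c - l * g, d - l * h)"
  let ?det = "(a - l * e) * (d - l * h) - (b - l * f) * (c - l * g)"
  have dets: "a * d - b * c = 1" "e * h - f * g = 1" using assms eq by (auto simp: mem_SL2)
  have Z: "act x v = scale l (act y v) \<longleftrightarrow> act ?Z v = 0" for v
    by (cases v) (auto simp: eq zero_prod_def algebra_simps)
  have count: "fixcount l x y = real (card {v. v \<noteq> 0 \<and> act ?Z v = 0})"
    unfolding fixcount_def Z ..
  have "?det = l\<^sup>2 * (e * h - f * g) - polar x y * l + (a * d - b * c)"
    by (simp add: eq algebra_simps power2_eq_square)
  then have det: "?det = 0 \<longleftrightarrow> l \<in> eigenvalues (polar x y)"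
    by (simp add: dets eigenvalues_def)
  \<comment> \<open>Determinants in x = l y give l^2 = 1.\<close>
  have scalar: "?Z = 0 \<longleftrightarrow> l = 1 \<and> x = y \<or> l = -1 \<and> x = - y"
  proof
    assume "?Z = 0"
    then have xy: "a = l * e" "b = l * f" "c = l * g" "d = l * h" by (auto simp: zero_prod_def)
    then have "l\<^sup>2 * (e * h - f * g) = 1"
      using dets(1) by (simp add: algebra_simps power2_eq_square)
    then have "l = 1 \<or> l = -1" by (simp add: dets power2_eq_1_iff)
    then show "l = 1 \<and> x = y \<or> l = -1 \<and> x = - y" by (auto simp: eq xy)
  qed (auto simp: eq zero_prod_def)
  have q: "real (CARD('a) - 1) = real CARD('a) - 1" by (simp add: of_nat_diff Suc_leI)
  consider "?Z = 0" | "?Z \<noteq> 0" "?det = 0" | "?det \<noteq> 0" by blast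
  then show ?thesis
  proof cases
    case 1
    have "{v. v \<noteq> 0 \<and> act ?Z v = 0} = UNIV - {0}"
      by (auto simp: 1[unfolded zero_prod_def] zero_prod_def)
    then have "fixcount l x y = real (CARD('a) * CARD('a) - 1)"
      by (simp add: count card_Diff_singleton)
    also have "\<dots> = real CARD('a) * real CARD('a) - 1"
      by (simp add: of_nat_diff Suc_leI)
    also have "\<dots> = (real CARD('a) - 1) * (1 + real CARD('a))" by (simp add: algebra_simps)
    finally have "fixcount l x y = (real CARD('a) - 1) * (1 + real CARD('a))" .
    moreover have "l \<in> eigenvalues (polar x y)" using 1 det by (simp add: zero_prod_def)
    ultimately show ?thesis using 1 scalar by simp
  next
    case 2
    have "(l = 1 \<and> x = y \<or> l = -1 \<and> x = - y) = False" "(l \<in> eigenvalues (polar x y)) = True"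
      using 2 scalar det by blast+
    then show ?thesis by (simp only: count card_kernel[OF 2(2,1)] q) simp
  next
    case 3
    have "v = 0" if "act ?Z v = 0" for v
    proof (cases v)
      case (Pair p r)
      have z: "(a - l * e) * p + (b - l * f) * r = 0" "(c - l * g) * p + (d - l * h) * r = 0"
        using that by (simp_all add: Pair zero_prod_def)
      \<comment> \<open>Cramer's rule: the adjugate applied to \<open>act ?Z v\<close> gives
        \<open>?det\<close> times \<open>v\<close>.\<close>
      have "?det * p = (d - l * h) * ((a - l * e) * p + (b - l * f) * r)
          - (b - l * f) * ((c - l * g) * p + (d - l * h) * r)"
        "?det * r = (a - l * e) * ((c - l * g) * p + (d - l * h) * r)
          - (c - l * g) * ((a - l * e) * p + (b - l * f) * r)"
        by (simp_all add: algebra_simps)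
      then show ?thesis using 3 by (simp add: Pair zero_prod_def z)
    qed
    then have none: "{v. v \<noteq> 0 \<and> act ?Z v = 0} = {}" by blast
    have "?Z \<noteq> 0" using 3 by (auto simp: zero_prod_def)
    then have "(l = 1 \<and> x = y \<or> l = -1 \<and> x = - y) = False" "(l \<in> eigenvalues (polar x y)) = False"
      using scalar det 3 by blast+
    then show ?thesis by (simp only: count none) simp
  qed
qed

lemma sum_fixcount:
  fixes x y :: "'a::{field,finite} mat22"
  assumes "(2::'a) \<noteq> 0" "x \<in> carrier SL2" "y \<in> carrier SL2" "0 \<notin> R"
  shows "(\<Sum>l\<in>R. fixcount l x y) = (real CARD('a) - 1) * (real (card (R \<inter> eigenvalues (polar x y)))
    + real CARD('a) * (of_bool (1 \<in> R \<and> x = y) + of_bool (-1 \<in> R \<and> x = - y)))"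
proof -
  have "(\<Sum>l\<in>R. fixcount l x y) = (\<Sum>l\<in>R. (real CARD('a) - 1) * (of_bool (l \<in> eigenvalues (polar x y))
    + real CARD('a) * (of_bool (l = 1) * of_bool (x = y) + of_bool (l = -1) * of_bool (x = - y))))"
    using assms minus_one_neq_one[OF assms(1)]
    by (intro sum.cong refl) (subst fixcount_eq, auto)
  also have "\<dots> = (real CARD('a) - 1) * (real (card (R \<inter> eigenvalues (polar x y)))
    + real CARD('a) * (of_bool (1 \<in> R \<and> x = y) + of_bool (-1 \<in> R \<and> x = - y)))"
    by (simp add: sum.distrib of_bool_def sum.If_cases flip: sum_distrib_left sum_distrib_right)
  finally show ?thesis .
qed

lemma fixcount_one_add_minus_one:
  fixes x y :: "'a::{field,finite} mat22"
  assumes "(2::'a) \<noteq> 0" "x \<in> carrier SL2" "y \<in> carrier SL2"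
  shows "fixcount 1 x y + fixcount (-1) x y
    = (real CARD('a) - 1) * (parabolic (polar x y) + real CARD('a) * delta x y)"
  using assms minus_one_neq_one[OF assms(1)]
  by (simp add: fixcount_eq mem_eigenvalues parabolic_def delta_def algebra_simps)

text \<open>\<open>parabolic\<close> and the number of eigenvalues are eliminated in favour of
  \<open>fixcount\<close>. The coefficient of \<open>delta\<close> collects to q (q - 1)^2 + q (q^2
  - 1) + 2 q (q - 1) = 2 q (q^2 - 1).\<close>

lemma cusp_kernel_fixcount:
  fixes x y :: "'a::{field,finite} mat22"
  assumes "(2::'a) \<noteq> 0" "x \<in> carrier SL2" "y \<in> carrier SL2"
  defines "q \<equiv> real CARD('a)"
  shows "(q - 1) * cusp_kernel x y = 2 * q * (q\<^sup>2 - 1) * delta x y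
    - (q + 1) * (fixcount 1 x y + fixcount (-1) x y) - 2 * (\<Sum>l\<in>UNIV - {0}. fixcount l x y) + 4 * (q - 1)"
proof -
  have "(UNIV - {0}) \<inter> eigenvalues (polar x y) = eigenvalues (polar x y)"
    using zero_notin_eigenvalues by auto
  then have "(\<Sum>l\<in>UNIV - {0}. fixcount l x y)
      = (q - 1) * (real (card (eigenvalues (polar x y))) + q * delta x y)"
    using sum_fixcount[OF assms(1-3), of "UNIV - {0}"] by (simp add: delta_def q_def)
  then show ?thesis
    unfolding fixcount_one_add_minus_one[OF assms(1-3)] cusp_kernel_def trace_weight_def q_def[symmetric]
    by algebra
qed

section \<open>Positive semidefiniteness of the kernel\<close>

lemma finite_SL2 [simp]: "finite (carrier (SL2 :: 'a::{field,finite} mat22 monoid))"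
  by (rule finite_subset[OF subset_UNIV]) simp

lemma fixcount_as_sum:
  fixes x y :: "'a::{field,finite} mat22"
  shows "fixcount l x y = (\<Sum>v\<in>UNIV - {0}. of_bool (act x v = scale l (act y v)))"
proof -
  have "{v. v \<noteq> 0 \<and> act x v = scale l (act y v)} = (UNIV - {0}) \<inter> {v. act x v = scale l (act y v)}"
    by auto
  then show ?thesis by (simp add: fixcount_def of_bool_def sum.If_cases)
qed

lemma scale_nonzero: "l \<noteq> 0 \<Longrightarrow> v \<noteq> 0 \<Longrightarrow> scale l v \<noteq> 0"
  by (cases v) (auto simp: zero_prod_def)

text \<open>
  The kernel is, up to a positive factor, an orthogonal projection: \<open>\<phi>\<close> is orthogonal to the
  functions \<open>\<lambda>g. fixcount l g y\<close> and to constants, so the square norm of \<open>\<phi>\<close> only sees the \<open>delta\<close> part.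
\<close>

lemma cusp_kernel_sum_nonneg:
  fixes F :: "'a::{field,finite} mat22 set"
  assumes two: "(2::'a) \<noteq> 0" and F: "F \<subseteq> carrier SL2" and sym: "\<And>x. x \<in> F \<Longrightarrow> - x \<in> F"
  shows "0 \<le> (\<Sum>x\<in>F. \<Sum>y\<in>F. cusp_kernel x y)"
proof -
  let ?S = "carrier (SL2 :: 'a mat22 monoid)"
  define q where "q = real CARD('a)"
  define \<phi> where "\<phi> g = (\<Sum>y\<in>F. cusp_kernel g y)" for g
  have "CARD('a) \<ge> card {0, 1::'a}" by (rule card_mono) auto
  then have q: "q \<ge> 2" by (simp add: q_def)
  have fiber: "(\<Sum>g\<in>?S. \<phi> g * of_bool (act g v = w)) = 0" if "v \<noteq> 0" "w \<noteq> 0" for v w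
  proof -
    have "(\<Sum>g\<in>?S. \<phi> g * of_bool (act g v = w)) = (\<Sum>g | g \<in> ?S \<and> act g v = w. \<phi> g)"
      by (simp add: of_bool_def if_distrib sum.If_cases Int_def cong: if_cong)
    also have "\<dots> = (\<Sum>y\<in>F. \<Sum>g | g \<in> ?S \<and> act g v = w. cusp_kernel g y)"
      unfolding \<phi>_def by (rule sum.swap)
    also have "\<dots> = 0"
      using sum_cusp_kernel_fiber[OF two _ that] F by (intro sum.neutral) auto
    finally show ?thesis .
  qed
  have fix0: "(\<Sum>g\<in>?S. \<phi> g * fixcount l g y) = 0" if "y \<in> F" "l \<noteq> 0" for l y
  proof -
    have "(\<Sum>g\<in>?S. \<phi> g * fixcount l g y)
        = (\<Sum>v\<in>UNIV - {0}. \<Sum>g\<in>?S. \<phi> g * of_bool (act g v = scale l (act y v)))"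
      unfolding fixcount_as_sum sum_distrib_left by (rule sum.swap)
    also have "\<dots> = 0"
      using that F by (intro sum.neutral ballI fiber scale_nonzero act_nonzero) auto
    finally show ?thesis .
  qed
  \<comment> \<open>Each g sends (1, 0) to exactly one nonzero w, so the fibers over (1, 0)
    partition SL(2,q).\<close>
  have total: "(\<Sum>g\<in>?S. \<phi> g) = 0"
  proof -
    have ne: "((1::'a), (0::'a)) \<noteq> 0" by (simp add: zero_prod_def)
    have "(\<Sum>g\<in>?S. \<phi> g) = (\<Sum>g\<in>?S. \<Sum>w\<in>UNIV - {0}. \<phi> g * of_bool (act g (1, 0) = w))"
      using act_nonzero[OF _ ne]
      by (intro sum.cong refl) (simp add: of_bool_def if_distrib cong: if_cong)
    also have "\<dots> = (\<Sum>w\<in>UNIV - {0}. \<Sum>g\<in>?S. \<phi> g * of_bool (act g (1, 0) = w))"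
      by (rule sum.swap)
    also have "\<dots> = 0"
      using fiber[OF ne] by (intro sum.neutral) auto
    finally show ?thesis .
  qed
  have delta: "(\<Sum>g\<in>?S. \<phi> g * delta g y) = \<phi> y + \<phi> (- y)" if "y \<in> F" for y
  proof -
    have "y \<in> ?S" using F that by blast
    moreover from this have "- y \<in> ?S" by (rule minus_closed)
    ultimately have "?S \<inter> {g. g = y} = {y}" "?S \<inter> {g. g = - y} = {- y}" by auto
    then show ?thesis by (simp add: delta_def distrib_left sum.distrib sum_mult_of_bool_eq)
  qed
  \<comment> \<open>One factor of the square is expanded over \<open>F\<close>, so that the
    decomposition of \<open>cusp_kernel g y\<close> into \<open>delta\<close>,
    \<open>fixcount\<close> and a constant applies.\<close>
  have "(q - 1) * (\<Sum>g\<in>?S. (\<phi> g)\<^sup>2) = (\<Sum>g\<in>?S. \<Sum>y\<in>F. \<phi> g * ((q - 1) * cusp_kernel g y))"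
  proof -
    have "(\<Sum>y\<in>F. \<phi> g * ((q - 1) * cusp_kernel g y)) = (q - 1) * (\<phi> g)\<^sup>2" for g
      unfolding sum_distrib_left[symmetric] \<phi>_def[symmetric] by (simp add: power2_eq_square)
    then show ?thesis by (simp add: sum_distrib_left)
  qed
  also have "\<dots> = (\<Sum>y\<in>F. \<Sum>g\<in>?S. \<phi> g * ((q - 1) * cusp_kernel g y))"
    by (rule sum.swap)
  also have "\<dots> = (\<Sum>y\<in>F. 2 * q * (q\<^sup>2 - 1) * (\<phi> y + \<phi> (- y)))"
  proof (rule sum.cong[OF refl])
    fix y assume y: "y \<in> F"
    have "(\<Sum>g\<in>?S. \<phi> g * ((q - 1) * cusp_kernel g y))
      = (\<Sum>g\<in>?S. 2 * q * (q\<^sup>2 - 1) * (\<phi> g * delta g y)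
        - (q + 1) * (\<phi> g * fixcount 1 g y) - (q + 1) * (\<phi> g * fixcount (-1) g y)
        - 2 * (\<Sum>l\<in>UNIV - {0}. \<phi> g * fixcount l g y) + 4 * (q - 1) * \<phi> g)"
    proof (rule sum.cong[OF refl])
      fix g assume g: "g \<in> ?S"
      have "y \<in> ?S" using y F by blast
      from cusp_kernel_fixcount[OF two g this] have "(q - 1) * cusp_kernel g y = 2 * q * (q\<^sup>2 - 1) * delta g y
        - (q + 1) * (fixcount 1 g y + fixcount (-1) g y) - 2 * (\<Sum>l\<in>UNIV - {0}. fixcount l g y)
        + 4 * (q - 1)"
        by (simp only: q_def)
      then show "\<phi> g * ((q - 1) * cusp_kernel g y) = 2 * q * (q\<^sup>2 - 1) * (\<phi> g * delta g y)
        - (q + 1) * (\<phi> g * fixcount 1 g y) - (q + 1) * (\<phi> g * fixcount (-1) g y)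
        - 2 * (\<Sum>l\<in>UNIV - {0}. \<phi> g * fixcount l g y) + 4 * (q - 1) * \<phi> g"
        unfolding sum_distrib_left[symmetric] by algebra
    qed
    also have "\<dots> = 2 * q * (q\<^sup>2 - 1) * (\<phi> y + \<phi> (- y))
        - 2 * (\<Sum>g\<in>?S. \<Sum>l\<in>UNIV - {0}. \<phi> g * fixcount l g y)"
      by (simp add: sum.distrib sum_subtractf fix0[OF y] total delta[OF y] flip: sum_distrib_left)
    also have "(\<Sum>g\<in>?S. \<Sum>l\<in>UNIV - {0}. \<phi> g * fixcount l g y) = 0"
      by (subst sum.swap) (simp add: fix0[OF y])
    finally show "(\<Sum>g\<in>?S. \<phi> g * ((q - 1) * cusp_kernel g y)) = 2 * q * (q\<^sup>2 - 1) * (\<phi> y + \<phi> (- y))"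
      by simp
  qed
  also have "\<dots> = 2 * q * (q\<^sup>2 - 1) * ((\<Sum>y\<in>F. \<phi> y) + (\<Sum>y\<in>F. \<phi> (- y)))"
    by (simp add: sum.distrib flip: sum_distrib_left)
  also have "(\<Sum>y\<in>F. \<phi> (- y)) = (\<Sum>y\<in>F. \<phi> y)"
    by (rule sum.reindex_bij_witness[where i = uminus and j = uminus]) (auto simp: sym)
  finally have eq: "(q - 1) * (\<Sum>g\<in>?S. (\<phi> g)\<^sup>2) = 4 * q * (q\<^sup>2 - 1) * (\<Sum>y\<in>F. \<phi> y)"
    by simp
  have "0 \<le> (q - 1) * (\<Sum>g\<in>?S. (\<phi> g)\<^sup>2)" using q by (simp add: sum_nonneg)
  moreover have "q\<^sup>2 - 1 > 0" using q by (simp add: power2_eq_square) (smt (verit) mult_less_cancel_left2 one_less_mult)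
  then have "4 * q * (q\<^sup>2 - 1) > 0" using q by simp
  ultimately have "0 \<le> (\<Sum>y\<in>F. \<phi> y)" unfolding eq by (metis mult_less_0_iff not_less)
  then show ?thesis by (simp add: \<phi>_def)
qed

section \<open>The bound for families in SL(2,q)\<close>

text \<open>For fixed v let \<open>N v w\<close> count the members of \<open>F\<close> sending v to
  w. The count for \<open>l\<close> is the inner product of \<open>N v\<close> with its rescaling by
  \<open>l\<close>. Rescaling permutes the vectors w, so both functions have the same norm.\<close>

lemma sum_fixcount_le:
  fixes F :: "'a::{field,finite} mat22 set"
  assumes "l \<noteq> 0"
  shows "(\<Sum>x\<in>F. \<Sum>y\<in>F. fixcount l x y) \<le> (\<Sum>x\<in>F. \<Sum>y\<in>F. fixcount 1 x y)"
proof -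
  define N where "N v w = (\<Sum>x\<in>F. of_bool (act x v = w) :: real)" for v w
  have pick: "(\<Sum>w\<in>UNIV. f w * of_bool (c = w)) = f c" for f :: "'a \<times> 'a \<Rightarrow> real" and c
    by (simp add: sum_mult_of_bool_eq)
  have count: "(\<Sum>x\<in>F. \<Sum>y\<in>F. fixcount k x y) = (\<Sum>v\<in>UNIV - {0}. \<Sum>w\<in>UNIV. N v (scale k w) * N v w)"
    for k :: 'a
  proof -
    have "(\<Sum>x\<in>F. \<Sum>y\<in>F. fixcount k x y)
        = (\<Sum>v\<in>UNIV - {0}. \<Sum>x\<in>F. \<Sum>y\<in>F. of_bool (act x v = scale k (act y v)))"
      unfolding fixcount_as_sum
      by (subst sum.swap, subst sum.swap, subst (2) sum.swap) (rule sum.swap)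
    also have "\<dots> = (\<Sum>v\<in>UNIV - {0}. \<Sum>w\<in>UNIV. N v (scale k w) * N v w)"
    proof (rule sum.cong[OF refl])
      fix v
      have "(\<Sum>w\<in>UNIV. N v (scale k w) * N v w)
        = (\<Sum>w\<in>UNIV. \<Sum>x\<in>F. \<Sum>y\<in>F. of_bool (act x v = scale k w) * of_bool (act y v = w))"
        unfolding N_def sum_product ..
      also have "\<dots> = (\<Sum>x\<in>F. \<Sum>y\<in>F. \<Sum>w\<in>UNIV. of_bool (act x v = scale k w) * of_bool (act y v = w))"
        by (subst sum.swap, subst (2) sum.swap) (rule refl)
      also have "\<dots> = (\<Sum>x\<in>F. \<Sum>y\<in>F. of_bool (act x v = scale k (act y v)))"
        by (simp only: pick)
      finally show "(\<Sum>x\<in>F. \<Sum>y\<in>F. of_bool (act x v = scale k (act y v)))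
        = (\<Sum>w\<in>UNIV. N v (scale k w) * N v w)" by simp
    qed
    finally show ?thesis .
  qed
  have one: "scale 1 w = w" for w :: "'a \<times> 'a" by (cases w) simp
  have "(\<Sum>w\<in>UNIV. N v (scale l w) * N v w) \<le> (\<Sum>w\<in>UNIV. N v w * N v w)" for v
  proof -
    have "N v (scale l w) * N v w \<le> (N v (scale l w) * N v (scale l w) + N v w * N v w) / 2" for w
      using sum_squares_bound[of "N v (scale l w)" "N v w"] by (simp add: power2_eq_square)
    then have "(\<Sum>w\<in>UNIV. N v (scale l w) * N v w)
        \<le> (\<Sum>w\<in>UNIV. (N v (scale l w) * N v (scale l w) + N v w * N v w) / 2)"
      by (rule sum_mono)
    also have "\<dots> = ((\<Sum>w\<in>UNIV. N v (scale l w) * N v (scale l w)) + (\<Sum>w\<in>UNIV. N v w * N v w)) / 2"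
      by (simp add: sum.distrib flip: sum_divide_distrib)
    also have "(\<Sum>w\<in>UNIV. N v (scale l w) * N v (scale l w)) = (\<Sum>w\<in>UNIV. N v w * N v w)"
      by (rule sum.reindex_bij_witness[where i = "scale (inverse l)" and j = "scale l"])
        (use assms in \<open>auto simp: mult.assoc[symmetric]\<close>)
    finally show ?thesis by simp
  qed
  then show ?thesis unfolding count one by (rule sum_mono)
qed

lemma card_intersecting_le:
  fixes F :: "'a::{field,finite} mat22 set"
  assumes two: "(2::'a) \<noteq> 0" and F: "F \<subseteq> carrier SL2" and sym: "\<And>x. x \<in> F \<Longrightarrow> - x \<in> F"
    and R: "0 \<notin> R" "\<And>a. a \<in> R \<Longrightarrow> inverse a \<in> R"
    and int: "\<And>x y. x \<in> F \<Longrightarrow> y \<in> F \<Longrightarrow> \<exists>a\<in>R. polar x y = a + inverse a"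
  shows "card F \<le> CARD('a) * card R"
proof (cases "F = {}")
  case False
  define q n where "q = real CARD('a)" and "n = real (card F)"
  define P where "P = (\<Sum>x\<in>F. \<Sum>y\<in>F. parabolic (polar x y))"
  have fin: "finite F" by (rule finite_subset[OF F]) simp
  have n: "n > 0" using False fin by (simp add: n_def card_gt_0_iff)
  have "CARD('a) \<ge> card {0, 1::'a}" by (rule card_mono) auto
  then have q: "q \<ge> 2" by (simp add: q_def)
  have delta: "(\<Sum>x\<in>F. \<Sum>y\<in>F. delta x y) = 2 * n"
  proof -
    have "(\<Sum>y\<in>F. delta x y) = 2" if "x \<in> F" for x
    proof -
      have "x = - y \<longleftrightarrow> y = - x" for y by auto
      then show ?thesis
        using that fin sym by (simp add: delta_def sum.distrib of_bool_def)
    qed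
    then show ?thesis by (simp add: n_def)
  qed
  \<comment> \<open>No quotient is elliptic, so the number of eigenvalues is 2 -
    \<open>parabolic\<close>; moreover they all lie in \<open>R\<close>, so the sum over
    \<open>R\<close> misses none.\<close>
  have pair: "cusp_kernel x y = q * (q - 1) * delta x y - (q - 1) * parabolic (polar x y)"
    "(\<Sum>l\<in>R. fixcount l x y) = (q - 1) * (2 - parabolic (polar x y) + q * delta x y)"
    if "x \<in> F" "y \<in> F" for x y
  proof -
    have xy: "x \<in> carrier SL2" "y \<in> carrier SL2" using that F by auto
    obtain a where a: "a \<in> R" "polar x y = a + inverse a" using int[OF \<open>x \<in> F\<close> \<open>y \<in> F\<close>] by blast
    then have a0: "a \<noteq> 0" using R by auto
    have c: "real (card (eigenvalues (polar x y))) = 2 - parabolic (polar x y)"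
      using card_eigenvalues[OF two a0] a by simp
    show "cusp_kernel x y = q * (q - 1) * delta x y - (q - 1) * parabolic (polar x y)"
      by (simp add: cusp_kernel_def trace_weight_def c q_def) (simp add: algebra_simps)
    have sub: "R \<inter> eigenvalues (polar x y) = eigenvalues (polar x y)"
      using eigenvalues_eq[OF a0] a R by auto
    \<comment> \<open>For x = y the trace is 2, which forces the element \<open>a\<close> of
      \<open>R\<close> to be 1; likewise x = -y forces -1.\<close>
    have "x = y \<Longrightarrow> 1 \<in> R" "x = - y \<Longrightarrow> -1 \<in> R"
    proof -
      have "polar y y = 2" "polar (- y) y = -2"
        using xy(2) by (cases y; simp add: mem_SL2; simp add: algebra_simps)+
      then show "x = y \<Longrightarrow> 1 \<in> R" "x = - y \<Longrightarrow> -1 \<in> R"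
        using a trace_eq_two_iff[OF a0] by auto
    qed
    then have "of_bool (1 \<in> R \<and> x = y) + of_bool (-1 \<in> R \<and> x = - y) = delta x y"
      by (auto simp: delta_def)
    then show "(\<Sum>l\<in>R. fixcount l x y) = (q - 1) * (2 - parabolic (polar x y) + q * delta x y)"
      using sum_fixcount[OF two xy R(1)] by (simp add: sub c q_def)
  qed
  have "0 \<le> (\<Sum>x\<in>F. \<Sum>y\<in>F. q * (q - 1) * delta x y - (q - 1) * parabolic (polar x y))"
    using cusp_kernel_sum_nonneg[OF two F sym] by (simp add: pair)
  also have "\<dots> = (q - 1) * (q * (2 * n) - P)"
    by (simp add: sum_subtractf delta P_def[symmetric] flip: sum_distrib_left) (simp add: algebra_simps)
  finally have P: "P \<le> 2 * q * n" using q by (simp add: zero_le_mult_iff)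

  define \<nu> where "\<nu> l = (\<Sum>x\<in>F. \<Sum>y\<in>F. fixcount l x y)" for l
  have "\<nu> 1 + \<nu> (-1) = (\<Sum>x\<in>F. \<Sum>y\<in>F. (q - 1) * (parabolic (polar x y) + q * delta x y))"
    unfolding \<nu>_def sum.distrib[symmetric] q_def
    using F by (intro sum.cong refl fixcount_one_add_minus_one[OF two]) auto
  also have "\<dots> = (q - 1) * (P + q * (2 * n))"
    by (simp add: sum.distrib delta P_def[symmetric] flip: sum_distrib_left)
  finally have "\<nu> 1 + \<nu> (-1) = (q - 1) * (P + q * (2 * n))" .
  \<comment> \<open>Replacing x by -x permutes \<open>F\<close> and exchanges the eigenvalues 1 and
    -1.\<close>
  moreover have "\<nu> (-1) = \<nu> 1"
  proof -
    have "fixcount (-1) x y = fixcount 1 (- x) y" for x y :: "'a mat22"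
    proof -
      have "act x v = scale (-1) (act y v) \<longleftrightarrow> act (- x) v = scale 1 (act y v)" for v
        by (cases "act y v") (auto simp: act_minus minus_equation_iff[of "act x v"])
      then show ?thesis by (simp add: fixcount_def)
    qed
    then have "\<nu> (-1) = (\<Sum>x\<in>F. \<Sum>y\<in>F. fixcount 1 (- x) y)" by (simp add: \<nu>_def)
    also have "\<dots> = \<nu> 1" unfolding \<nu>_def
      by (rule sum.reindex_bij_witness[where i = uminus and j = uminus]) (auto simp: sym)
    finally show ?thesis .
  qed
  moreover have "(q - 1) * (P + q * (2 * n)) \<le> (q - 1) * (4 * q * n)"
    using P q by (intro mult_left_mono) (auto simp: algebra_simps)
  ultimately have \<nu>1: "2 * \<nu> 1 \<le> (q - 1) * (4 * q * n)" by linarith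
  \<comment> \<open>The bound on \<open>P\<close> enters a second time, now as a lower bound for the
    sum over \<open>R\<close>.\<close>
  have "(q - 1) * (2 * n\<^sup>2) \<le> (q - 1) * (2 * n\<^sup>2 - P + q * (2 * n))"
    using P q by (intro mult_left_mono) auto
  also have "\<dots> = (\<Sum>x\<in>F. \<Sum>y\<in>F. (q - 1) * (2 - parabolic (polar x y) + q * delta x y))"
    by (simp add: sum.distrib sum_subtractf delta P_def[symmetric] n_def[symmetric] power2_eq_square
        flip: sum_distrib_left)
  also have "\<dots> = (\<Sum>x\<in>F. \<Sum>y\<in>F. \<Sum>l\<in>R. fixcount l x y)"
    by (simp add: pair)
  also have "\<dots> = (\<Sum>l\<in>R. \<nu> l)"
    unfolding \<nu>_def by (simp add: sum.swap[of _ R])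
  also have "\<dots> \<le> (\<Sum>l\<in>R. \<nu> 1)"
    unfolding \<nu>_def using R by (intro sum_mono sum_fixcount_le) auto
  also have "\<dots> = real (card R) * \<nu> 1" by simp
  also have "2 * \<dots> \<le> (q - 1) * (2 * n * (2 * q * real (card R)))"
    using mult_left_mono[OF \<nu>1, of "real (card R)"] by (simp add: algebra_simps)
  finally have "(q - 1) * (2 * n) * n \<le> (q - 1) * (2 * n) * (q * real (card R))"
    by (simp add: algebra_simps power2_eq_square)
  then have "n \<le> q * real (card R)" using q n by simp
  then show ?thesis unfolding n_def q_def by (simp flip: of_nat_mult)
qed simp

section \<open>Passage from SL(2,q) to PSL(2,q)\<close>

lemma SL2_mult_one [simp]: "mult SL2 = mat22_mult" "one SL2 = (1, 0, 0, 1)"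
  by (simp_all add: SL2_def)

lemma group_SL2: "group (SL2 :: 'a::field mat22 monoid)"
proof (rule groupI)
  fix x :: "'a mat22" assume "x \<in> carrier SL2"
  then show "\<exists>y\<in>carrier SL2. y \<otimes>\<^bsub>SL2\<^esub> x = \<one>\<^bsub>SL2\<^esub>"
    by (intro bexI[of _ "adjugate x"]) (simp_all add: adjugate_closed adjugate_inverse)
qed (simp_all add: mult_closed one_closed mat22_assoc mult_one)

lemma psl_class_eq: "psl_class x = {x, - x}"
  by (cases x) (auto simp: psl_class_def r_coset_def SL2_center_def)

lemma psl_class_eq_iff: "psl_class x = psl_class y \<longleftrightarrow> x = y \<or> x = - y"
  by (auto simp: psl_class_eq doubleton_eq_iff)

lemma SL2_center_normal: "SL2_center \<lhd> (SL2 :: 'a::field mat22 monoid)"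
proof -
  interpret group "SL2 :: 'a mat22 monoid" by (rule group_SL2)
  have "subgroup SL2_center (SL2 :: 'a mat22 monoid)"
  proof (rule subgroupI)
    fix x :: "'a mat22" assume x: "x \<in> SL2_center"
    then have "inv\<^bsub>SL2\<^esub> x = x"
      by (intro inv_equality) (auto simp: SL2_center_def mem_SL2)
    then show "inv\<^bsub>SL2\<^esub> x \<in> SL2_center" using x by simp
  qed (auto simp: SL2_center_def mem_SL2)
  moreover have "SL2_center #>\<^bsub>SL2\<^esub> x = x <#\<^bsub>SL2\<^esub> SL2_center" for x :: "'a mat22"
    by (cases x) (auto simp: r_coset_def l_coset_def SL2_center_def)
  ultimately show ?thesis by (simp add: normalI)
qed

lemma group_PSL2: "group (PSL2 :: 'a::field mat22 set monoid)"
  unfolding PSL2_def by (rule normal.factorgroup_is_group[OF SL2_center_normal])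

lemma carrier_PSL2: "carrier PSL2 = psl_class ` carrier SL2"
  by (auto simp: PSL2_def FactGroup_def RCOSETS_def psl_class_def)

lemma PSL2_mult: "psl_class x \<otimes>\<^bsub>PSL2\<^esub> psl_class y = psl_class (mat22_mult x y)"
  by (auto simp: PSL2_def FactGroup_def set_mult_def psl_class_eq mult_minus)

lemma PSL2_one: "\<one>\<^bsub>PSL2\<^esub> = psl_class (1, 0, 0, 1)"
  by (auto simp: PSL2_def FactGroup_def psl_class_eq SL2_center_def)

lemma PSL2_inv:
  assumes "x \<in> carrier SL2"
  shows "inv\<^bsub>PSL2\<^esub> (psl_class x) = psl_class (adjugate x)"
  using assms
  by (intro group.inv_equality[OF group_PSL2])
    (simp_all add: PSL2_mult PSL2_one carrier_PSL2 adjugate_inverse adjugate_closed)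

text \<open>The members of \<open>C\<close> are two-element orbits of an involution, hence
  disjoint.\<close>

lemma card_Union_involution:
  assumes "\<And>x. f (f x) = x" "\<And>A. A \<in> C \<Longrightarrow> \<exists>x. f x \<noteq> x \<and> A = {x, f x}"
  shows "card (\<Union>C) = 2 * card C"
proof -
  have two: "card A = 2" if A: "A \<in> C" for A
  proof -
    obtain x where "f x \<noteq> x" "A = {x, f x}" using assms(2)[OF A] by blast
    then show ?thesis by auto
  qed
  have "pairwise disjnt C"
    unfolding pairwise_def disjnt_def using assms by (smt (verit, best) disjoint_iff insert_commute insert_iff singletonD)
  then have "card (\<Union>C) = (\<Sum>A\<in>C. card A)"
    using two by (intro card_Union_disjoint) (auto intro: card_ge_0_finite)
  also have "\<dots> = 2 * card C" using two by simp
  finally show ?thesis .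
qed

text \<open>If 2 = 0, then x -> x + 1 is an involution without fixed points, which pairs off the
  field elements.\<close>

lemma two_neq_zero_of_odd_card:
  assumes "odd CARD('a::{field,finite})"
  shows "(2::'a) \<noteq> 0"
proof
  assume "(2::'a) = 0"
  then have "x + 1 + 1 = x" for x :: 'a by (simp add: add.assoc)
  then have "card (\<Union>(range (\<lambda>x::'a. {x, x + 1}))) = 2 * card (range (\<lambda>x::'a. {x, x + 1}))"
    by (intro card_Union_involution[where f = "\<lambda>x. x + 1"]) auto
  moreover have "\<Union>(range (\<lambda>x::'a. {x, x + 1})) = UNIV" by auto
  ultimately show False using assms by simp
qed

section \<open>The subgroup \<open>M_r\<close> as classes of triangular matrices\<close>

definition nonzero_powers :: "nat \<Rightarrow> 'a::field set" where
  "nonzero_powers r = (\<lambda>y. y ^ r) ` (UNIV - {0})"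

lemma zero_notin_nonzero_powers: "0 \<notin> nonzero_powers r"
  by (auto simp: nonzero_powers_def)

text \<open>Closure under negation is where the parity of \<open>r\<close> enters: (-1)^r = -1 for
  odd \<open>r\<close>.\<close>

lemma nonzero_powers_closed:
  "1 \<in> nonzero_powers r"
  "a \<in> nonzero_powers r \<Longrightarrow> b \<in> nonzero_powers r \<Longrightarrow> a * b \<in> nonzero_powers r"
  "a \<in> nonzero_powers r \<Longrightarrow> inverse a \<in> nonzero_powers r"
  "odd r \<Longrightarrow> a \<in> nonzero_powers r \<Longrightarrow> - a \<in> nonzero_powers r"
proof -
  show "1 \<in> nonzero_powers r"
    by (auto simp: nonzero_powers_def intro!: image_eqI[of _ _ 1])
  show "a * b \<in> nonzero_powers r" if "a \<in> nonzero_powers r" "b \<in> nonzero_powers r"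
    using that by (auto simp: nonzero_powers_def simp flip: power_mult_distrib)
  show "inverse a \<in> nonzero_powers r" if "a \<in> nonzero_powers r"
    using that by (auto simp: nonzero_powers_def simp flip: power_inverse)
  show "- a \<in> nonzero_powers r" if "odd r" "a \<in> nonzero_powers r"
    using that by (auto simp: nonzero_powers_def simp flip: power_minus_odd)
qed

definition triangular :: "'a::field set \<Rightarrow> 'a mat22 set" where
  "triangular R = (\<lambda>(a, x). (a, x, 0, inverse a)) ` (R \<times> UNIV)"

lemma triangularI: "a \<in> R \<Longrightarrow> (a, x, 0, inverse a) \<in> triangular R"
  by (auto simp: triangular_def)

lemma card_triangular: "card (triangular (R :: 'a::{field,finite} set)) = CARD('a) * card R"
  unfolding triangular_def by (subst card_image) (auto simp: inj_on_def card_cartesian_product)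

lemma triangular_subset_SL2: "0 \<notin> R \<Longrightarrow> triangular R \<subseteq> carrier SL2"
  by (auto simp: triangular_def mem_SL2) (metis right_inverse)

lemma subgroup_triangular:
  "subgroup (psl_class ` triangular (nonzero_powers r :: 'a::field set)) PSL2"
proof (rule group.subgroupI[OF group_PSL2])
  let ?T = "triangular (nonzero_powers r :: 'a set)"
  note T = triangular_subset_SL2[OF zero_notin_nonzero_powers]
  show "psl_class ` ?T \<subseteq> carrier PSL2" using T by (auto simp: carrier_PSL2)
  show "psl_class ` ?T \<noteq> {}"
    using nonzero_powers_closed(1) by (auto simp: triangular_def)
  fix g assume "g \<in> psl_class ` ?T"
  then obtain a x where g: "g = psl_class (a, x, 0, inverse a)" "a \<in> nonzero_powers r"
    by (auto simp: triangular_def)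
  then have "a \<noteq> 0" using zero_notin_nonzero_powers by metis
  then have "inv\<^bsub>PSL2\<^esub> g = psl_class (inverse a, - x, 0, inverse (inverse a))"
    unfolding g(1) by (subst PSL2_inv) (auto simp: mem_SL2)
  then show "inv\<^bsub>PSL2\<^esub> g \<in> psl_class ` ?T"
    using nonzero_powers_closed(3)[OF g(2)] triangularI by blast
  fix h assume "h \<in> psl_class ` ?T"
  then obtain b y where h: "h = psl_class (b, y, 0, inverse b)" "b \<in> nonzero_powers r"
    by (auto simp: triangular_def)
  have "g \<otimes>\<^bsub>PSL2\<^esub> h = psl_class (a * b, a * y + x * inverse b, 0, inverse (a * b))"
    by (simp add: g h PSL2_mult)
  then show "g \<otimes>\<^bsub>PSL2\<^esub> h \<in> psl_class ` ?T"
    using nonzero_powers_closed(2)[OF g(2) h(2)] triangularI by blast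
qed

lemma diagA_power: "diagA \<omega> [^]\<^bsub>PSL2\<^esub> (k::nat) = psl_class (\<omega> ^ k, 0, 0, inverse (\<omega> ^ k))"
proof (induction k)
  case 0
  interpret group "PSL2 :: 'a mat22 set monoid" by (rule group_PSL2)
  show ?case by (simp add: PSL2_one)
next
  case (Suc k)
  interpret group "PSL2 :: 'a mat22 set monoid" by (rule group_PSL2)
  show ?case by (simp add: Suc) (simp add: diagA_def PSL2_mult mult.commute)
qed

text \<open>The triangular classes form a subgroup containing the generators; conversely each of
  them is a unipotent class times a power of the r-th power of
  \<open>diagA \<omega>\<close>.\<close>

lemma M_r_eq:
  fixes \<omega> :: "'a::field"
  assumes "\<omega> \<noteq> 0" and gen: "\<forall>y::'a. y \<noteq> 0 \<longrightarrow> (\<exists>k::nat. y = \<omega> ^ k)"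
  shows "M_r \<omega> r = psl_class ` triangular (nonzero_powers r)"
proof
  interpret group "PSL2 :: 'a mat22 set monoid" by (rule group_PSL2)
  have "psl_class (1, x, 0, 1) \<in> psl_class ` triangular (nonzero_powers r)" for x :: 'a
    using nonzero_powers_closed(1)[of r] by (force simp: triangular_def)
  moreover have "psl_class (\<omega> ^ r, 0, 0, inverse (\<omega> ^ r)) \<in> psl_class ` triangular (nonzero_powers r)"
    using assms(1) by (force simp: triangular_def nonzero_powers_def)
  ultimately show "M_r \<omega> r \<subseteq> psl_class ` triangular (nonzero_powers r)"
    unfolding M_r_def
    by (intro generate_subgroup_incl subgroup_triangular) (auto simp: H0_def diagA_power)
  show "psl_class ` triangular (nonzero_powers r) \<subseteq> M_r \<omega> r"
  proof
    fix g :: "'a mat22 set" assume "g \<in> psl_class ` triangular (nonzero_powers r)"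
    then obtain y x where "y \<noteq> 0" and g: "g = psl_class (y ^ r, x, 0, inverse (y ^ r))"
      by (auto simp: triangular_def nonzero_powers_def)
    then obtain k where y: "y = \<omega> ^ k" using gen by blast
    define B where "B j = psl_class ((\<omega> ^ r) ^ j, 0, 0, inverse ((\<omega> ^ r) ^ j))" for j
    have A: "B 1 \<in> M_r \<omega> r"
      unfolding M_r_def by (rule generate.incl) (simp add: diagA_power B_def)
    have diag: "B j \<in> M_r \<omega> r" for j
    proof (induction j)
      case 0
      show ?case using generate.one[of PSL2] by (simp add: B_def M_r_def PSL2_one)
    next
      case (Suc j)
      have "B (Suc j) = B 1 \<otimes>\<^bsub>PSL2\<^esub> B j" by (simp add: B_def PSL2_mult)
      then show ?case using A Suc unfolding M_r_def by (simp add: generate.eng)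
    qed
    \<comment> \<open>The factor \<open>y ^ r\<close> compensates the entry
      \<open>inverse (y ^ r)\<close> of the diagonal factor on the right.\<close>
    have "psl_class (1, x * y ^ r, 0, 1) \<in> M_r \<omega> r"
      unfolding M_r_def by (rule generate.incl) (auto simp: H0_def)
    moreover have "g = psl_class (1, x * y ^ r, 0, 1) \<otimes>\<^bsub>PSL2\<^esub> B k"
      using \<open>y \<noteq> 0\<close>
      by (simp add: g B_def PSL2_mult y mult.assoc mult.commute[of k r] flip: power_mult)
    ultimately show "g \<in> M_r \<omega> r"
      using diag unfolding M_r_def by (simp add: generate.eng)
  qed
qed

section \<open>Lifting intersecting families and the conclusion\<close>

lemma minus_neq_self:
  assumes "(2::'a::field) \<noteq> 0" "x \<in> carrier (SL2 :: 'a mat22 monoid)"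
  shows "- x \<noteq> x"
proof
  have eq: "- a = a \<longleftrightarrow> a = 0" for a :: 'a
  proof -
    have "a - - a = 2 * a" by simp
    then show ?thesis using assms(1) by (metis eq_iff_diff_eq_0 mult_eq_0_iff)
  qed
  assume "- x = x"
  then show False using assms(2) by (cases x) (simp add: mem_SL2 eq)
qed

lemma card_Union_psl_classes:
  fixes C :: "'a::{field,finite} mat22 set set"
  assumes "(2::'a) \<noteq> 0" "C \<subseteq> carrier PSL2"
  shows "card (\<Union>C) = 2 * card C"
proof (rule card_Union_involution[where f = uminus])
  fix A assume "A \<in> C"
  then obtain x where "x \<in> carrier SL2" "A = psl_class x" using assms(2) carrier_PSL2 by blast
  then show "\<exists>x. - x \<noteq> x \<and> A = {x, - x}"
    using minus_neq_self[OF assms(1)] psl_class_eq by blast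
qed simp

lemma mem_Union_psl_classes:
  assumes "F \<subseteq> carrier PSL2" "x \<in> \<Union>F"
  shows "x \<in> carrier SL2" "psl_class x \<in> F" "- x \<in> \<Union>F"
proof -
  obtain g where g: "x \<in> g" "g \<in> F" using assms(2) by blast
  then obtain z where z: "z \<in> carrier SL2" "g = psl_class z"
    using assms(1) carrier_PSL2 by blast
  then have "x = z \<or> x = - z" using g by (simp add: psl_class_eq)
  then show "x \<in> carrier SL2" "psl_class x \<in> F"
    using z g minus_closed psl_class_eq_iff by metis+
  then show "- x \<in> \<Union>F" by (simp add: psl_class_eq) blast
qed

text \<open>Equal cosets of x z and y z make the quotient of x by y conjugate, up to sign, to a
  triangular matrix, whose trace is a + 1/a.\<close>

lemma intersecting_lift_polar:
  fixes F :: "'a::field mat22 set set"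
  assumes F: "H_intersecting PSL2 (psl_class ` triangular R) F"
    and R: "0 \<notin> R" "1 \<in> R" "\<And>a. a \<in> R \<Longrightarrow> - a \<in> R"
    and xy: "x \<in> \<Union>F" "y \<in> \<Union>F"
  shows "\<exists>a\<in>R. polar x y = a + inverse a"
proof -
  let ?T = "triangular R"
  have "F \<subseteq> carrier PSL2" using F by (simp add: H_intersecting_def)
  then have x: "x \<in> carrier SL2" "psl_class x \<in> F" and y: "y \<in> carrier SL2" "psl_class y \<in> F"
    using xy mem_Union_psl_classes by blast+
  obtain g where "g \<in> carrier PSL2"
    "(psl_class x \<otimes>\<^bsub>PSL2\<^esub> g) <#\<^bsub>PSL2\<^esub> (psl_class ` ?T)
      = (psl_class y \<otimes>\<^bsub>PSL2\<^esub> g) <#\<^bsub>PSL2\<^esub> (psl_class ` ?T)"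
    using F x(2) y(2) unfolding H_intersecting_def by blast
  then obtain z where z: "z \<in> carrier SL2"
    and eq: "psl_class (mat22_mult x z) <#\<^bsub>PSL2\<^esub> (psl_class ` ?T)
      = psl_class (mat22_mult y z) <#\<^bsub>PSL2\<^esub> (psl_class ` ?T)"
    unfolding carrier_PSL2 by (metis imageE PSL2_mult)
  have one: "(1, 0, 0, 1) \<in> ?T" using R(2) by (force simp: triangular_def)
  have "psl_class (mat22_mult y z) \<in> psl_class (mat22_mult y z) <#\<^bsub>PSL2\<^esub> (psl_class ` ?T)"
    unfolding l_coset_def by (rule UN_I[OF imageI[OF one]]) (simp only: PSL2_mult mult_one singleton_iff)
  then obtain h where h: "h \<in> ?T" "psl_class (mat22_mult y z) = psl_class (mat22_mult (mat22_mult x z) h)"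
    unfolding eq[symmetric] by (auto simp: l_coset_def PSL2_mult)
  \<comment> \<open>Equality of classes fixes the product only up to sign; closure of
    \<open>R\<close> under negation absorbs the sign into h.\<close>
  have "- h \<in> ?T" using h(1) R(3) by (force simp: triangular_def)
  then obtain h' where h': "h' \<in> ?T" "mat22_mult y z = mat22_mult (mat22_mult x z) h'"
    using h unfolding psl_class_eq_iff by (metis mult_minus(2))
  then obtain a u where a: "a \<in> R" "h' = (a, u, 0, inverse a)" by (auto simp: triangular_def)
  have "polar x y = polar (mat22_mult x z) (mat22_mult y z)"
    using z by (simp add: polar_mult_right)
  also have "\<dots> = polar (mat22_mult (mat22_mult x z) (1, 0, 0, 1)) (mat22_mult (mat22_mult x z) h')"
    by (simp only: h'(2) mult_one)
  also have "\<dots> = polar (1, 0, 0, 1) h'"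
    using x z by (intro polar_mult_left mult_closed)
  also have "\<dots> = a + inverse a" by (simp add: a)
  finally show ?thesis using a by blast
qed

theorem theorem1p4:
  fixes \<omega> :: "'a::{field, finite}" and r :: nat
  assumes "card (UNIV :: 'a set) mod 4 = 1"
    and "\<forall>y::'a. y \<noteq> 0 \<longrightarrow> (\<exists>k::nat. y = \<omega> ^ k)"
    and "odd r" and "r dvd (card (UNIV :: 'a set) - 1) div 2"
  shows "intersection_density (PSL2 :: ('a mat22 set) monoid) (M_r \<omega> r) = 1"
proof -
  let ?G = "PSL2 :: 'a mat22 set monoid"
  let ?R = "nonzero_powers r :: 'a set"
  interpret group ?G by (rule group_PSL2)
  have "odd CARD('a)" using assms(1) by presburger
  then have two: "(2::'a) \<noteq> 0" by (rule two_neq_zero_of_odd_card)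
  \<comment> \<open>The only powers of 0 are 1 and 0, and -1 is neither.\<close>
  have "\<omega> \<noteq> 0"
  proof
    assume "\<omega> = 0"
    moreover obtain k where "-1 = \<omega> ^ k" using assms(2) by fastforce
    ultimately show False using minus_one_neq_one[OF two] by (cases k) auto
  qed
  then have M: "M_r \<omega> r = psl_class ` triangular ?R" by (rule M_r_eq[OF _ assms(2)])
  have sub: "subgroup (M_r \<omega> r) ?G" unfolding M by (rule subgroup_triangular)
  have M_sub: "M_r \<omega> r \<subseteq> carrier ?G" by (rule subgroup.subset[OF sub])
  \<comment> \<open>As -1 is an r-th power, the triangular matrices are the full preimage of
    \<open>M_r\<close>, twice its size.\<close>
  have "\<Union>(M_r \<omega> r) = triangular ?R"
  proof -
    have "- x \<in> triangular ?R" if "x \<in> triangular ?R" for x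
      using that nonzero_powers_closed(4)[OF assms(3)] by (force simp: triangular_def)
    then show ?thesis by (auto simp: M psl_class_eq)
  qed
  then have card_M: "2 * card (M_r \<omega> r) = CARD('a) * card ?R"
    using card_Union_psl_classes[OF two M_sub] by (simp add: card_triangular)
  have M_pos: "card (M_r \<omega> r) > 0"
    using subgroup.one_closed[OF sub] by (auto simp: card_gt_0_iff)
  have bound: "card F \<le> card (M_r \<omega> r)" if F: "H_intersecting ?G (M_r \<omega> r) F" for F
  proof -
    have "F \<subseteq> carrier ?G" using F by (simp add: H_intersecting_def)
    have "card (\<Union>F) \<le> CARD('a) * card ?R"
    proof (rule card_intersecting_le[OF two])
      show "\<Union>F \<subseteq> carrier SL2" "\<And>x. x \<in> \<Union>F \<Longrightarrow> - x \<in> \<Union>F"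
        using mem_Union_psl_classes[OF \<open>F \<subseteq> carrier ?G\<close>] by blast+
      show "\<exists>a\<in>?R. polar x y = a + inverse a" if "x \<in> \<Union>F" "y \<in> \<Union>F" for x y
        by (rule intersecting_lift_polar[OF F[unfolded M] zero_notin_nonzero_powers
              nonzero_powers_closed(1) nonzero_powers_closed(4)[OF assms(3)] that])
    qed (auto intro: zero_notin_nonzero_powers nonzero_powers_closed(3) simp: zero_notin_nonzero_powers)
    then show ?thesis
      using card_Union_psl_classes[OF two \<open>F \<subseteq> carrier ?G\<close>] card_M by simp
  qed
  \<comment> \<open>The bound is attained by the subgroup itself: with x the identity, both cosets
    equal \<open>M_r\<close>.\<close>
  have "H_intersecting ?G (M_r \<omega> r) (M_r \<omega> r)"
    unfolding H_intersecting_def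
  proof (intro conjI ballI)
    fix g h assume "g \<in> M_r \<omega> r" "h \<in> M_r \<omega> r"
    then show "\<exists>x\<in>carrier ?G. (g \<otimes>\<^bsub>?G\<^esub> x) <#\<^bsub>?G\<^esub> M_r \<omega> r = (h \<otimes>\<^bsub>?G\<^esub> x) <#\<^bsub>?G\<^esub> M_r \<omega> r"
      using M_sub by (intro bexI[of _ "\<one>\<^bsub>?G\<^esub>"]) (auto simp: coset_join3[OF _ sub] subsetD)
  qed (rule M_sub)
  then show ?thesis
    unfolding intersection_density_def
    using bound M_pos by (intro Max_eqI) (auto intro!: image_eqI[of _ _ "M_r \<omega> r"])
qed

end
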